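(* Let $F$ be a probability distribution on $\mathbb{R}\cup\{-\infty\}$ such that $F([1-\epsilon,1])>0$ for all $\epsilon>0$ and $F((1,\infty))=0$. Let $(\nu(t),\,t\ge0)$ be a Max Growth System with charge distribution $F$ such that $\nu(0)=\delta_0$, and let $(W_t,\,t\ge0)$ be the maximal charges of paths from $0$ to $t$ in the complete directed acyclic graph with i.i.d. edge charges of law $F$. Then the following equality in distribution of processes holds: $$(\nu(t),\,t\ge0)\ \overset{(d)}{=}\ \Big(\sum_{j=0}^t\delta_{W_j},\,t\ge0\Big).$$
   Context: Convention: $-\infty+x=-\infty$ for all $x\in\mathbb{R}\cup\{-\infty\}$. Time $t$ runs over integers. Point measures. $\mathcal{N}$ is the set of locally finite point measures $\nu$ on $\mathbb{R}\cup\{-\infty\}$ with a finite maximal element, i.e. measures with nonnegative integer values that are finite on every interval $[x,\infty)$, $x\in\mathbb{R}$, and whose largest atom, if $\nu\ne0$, is a real number. Such a $\nu$ is identified with the (finite or infinite) nonincreasing sequence $\nu_1\ge\nu_2\ge\cdots\ge-\infty$ of the locations of its atoms, counted with multiplicity. Its number of atoms is $\|\nu\|$. Max Growth System. $\mathcal{W}$ is the set of sequences $w=(w_1,w_2,\ldots)$ in $\mathbb{R}\cup\{-\infty\}$ with $\sup_k w_k\le 1$. For $\nu\in\mathcal{N}$, $\nu\neq0$, and $w\in\mathcal{W}$, set $\mathfrak m(\nu,w):=\sup_k(\nu_k+w_k)$, the supremum being over all $k\ge1$ if $\|\nu\|=\infty$ and over $1\le k\le\|\nu\|$ otherwise, and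 $\Psi_w\nu:=\nu+\delta_{\mathfrak m(\nu,w)}$. A Max Growth System with charge distribution $F$ started from $\nu(0)$ is the process defined by $\nu(t+1)=\Psi_{w(t+1)}\nu(t)$, $t\ge0$, where $w(t)=(w_1(t),w_2(t),\ldots)$ and $(w_j(t),\,j\ge1,\,t\in\mathbb{Z})$ are i.i.d. with law $F$. Paths. Let $(w_{i,j},\,0\le i<j)$ be i.i.d. with law $F$. A path from $0$ to $n$ is an increasing sequence of integers $0=i_0<i_1<\cdots<i_k=n$, with charge $w_{i_0,i_1}+\cdots+w_{i_{k-1},i_k}$; the charge of a path consisting of a single vertex is $0$. $W_n$ is the maximum of the charges of all paths from $0$ to $n$ (so $W_0=0$). *)

theory Defs
  imports "HOL-Probability.Probability"
begin

section \<open>Charges and point measures\<close>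

abbreviation charge_space :: "ereal measure" where
  "charge_space \<equiv> restrict_space borel {-\<infinity>..<\<infinity>}"

text \<open>
  The values lie in \<open>{0, 1, 2, \<dots>, \<infinity>}\<close>: infinite mass is allowed on sets that
  accumulate at \<open>-\<infinity>\<close> or contain \<open>-\<infinity>\<close>.
\<close>

definition point_measures :: "ereal measure set" where
  "point_measures = {\<nu>. sets \<nu> = sets charge_space
     \<and> (\<forall>A\<in>sets \<nu>. emeasure \<nu> A \<in> insert \<infinity> (range of_nat))
     \<and> (\<forall>x::real. emeasure \<nu> {ereal x..<\<infinity>} < \<infinity>)
     \<and> (emeasure \<nu> (space \<nu>) \<noteq> 0 \<longrightarrow>
          (\<exists>x::real. emeasure \<nu> {ereal x} \<noteq> 0 \<and> emeasure \<nu> {ereal x<..<\<infinity>} = 0))}"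

text \<open>
  The \<open>\<sigma>\<close>-algebra on point measures is the one generated by the evaluations
  \<open>\<nu> \<mapsto> \<nu>(A)\<close>, as for the Giry monad.
\<close>

definition point_measure_space :: "ereal measure measure" where
  "point_measure_space =
     (SUP A\<in>sets charge_space. vimage_algebra point_measures (\<lambda>\<nu>. emeasure \<nu> A) borel)"

definition sum_measure :: "'b measure \<Rightarrow> 'i set \<Rightarrow> ('i \<Rightarrow> 'b measure) \<Rightarrow> 'b measure" where
  "sum_measure S I \<mu> = measure_of (space S) (sets S) (\<lambda>A. \<Sum>i\<in>I. emeasure (\<mu> i) A)"

definition add_measure :: "'b measure \<Rightarrow> 'b measure \<Rightarrow> 'b measure" where
  "add_measure \<mu> \<nu> = measure_of (space \<mu>) (sets \<mu>) (\<lambda>A. emeasure \<mu> A + emeasure \<nu> A)"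

text \<open>
  \<open>kth_atom \<nu> k\<close> is the location \<open>\<nu>\<^sub>k\<close> of the \<open>k\<close>-th largest atom, counted with multiplicity;
  it is meant for \<open>1 \<le> k \<le> \<parallel>\<nu>\<parallel>\<close>, where \<open>\<parallel>\<nu>\<parallel>\<close> is the total mass.  See
  \<open>le_kth_atom_iff\<close> below: the number of \<open>k\<close> with \<open>\<nu>\<^sub>k \<ge> x\<close> is \<open>\<nu>([x,\<infinity>))\<close>.
\<close>

definition kth_atom :: "ereal measure \<Rightarrow> nat \<Rightarrow> ereal" where
  "kth_atom \<nu> k = Sup {x. x < \<infinity> \<and> of_nat k \<le> emeasure \<nu> {x..<\<infinity>}}"

section \<open>Independent charges and the Max Growth System\<close>

definition iid_charges ::
    "'a measure \<Rightarrow> ereal measure \<Rightarrow> 'i set \<Rightarrow> ('i \<Rightarrow> 'a \<Rightarrow> ereal) \<Rightarrow> bool" where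
  "iid_charges M F I X \<longleftrightarrow>
     prob_space M \<and> prob_space.indep_vars M (\<lambda>_. charge_space) X I
     \<and> (\<forall>i\<in>I. distr M charge_space (X i) = F)"

definition max_charge_position :: "ereal measure \<Rightarrow> (nat \<Rightarrow> ereal) \<Rightarrow> ereal" where
  "max_charge_position \<nu> w =
     (SUP k\<in>{k. 1 \<le> k \<and> of_nat k \<le> emeasure \<nu> (space \<nu>)}. kth_atom \<nu> k + w k)"

definition mgs_step :: "(nat \<Rightarrow> ereal) \<Rightarrow> ereal measure \<Rightarrow> ereal measure" where
  "mgs_step w \<nu> = add_measure \<nu> (return charge_space (max_charge_position \<nu> w))"

text \<open>
  The recursion is imposed at every outcome.  For a law \<open>F\<close> that does not charge \<open>(1,\<infinity>)\<close>,
  the sequence \<open>w\<^sub>1(t), w\<^sub>2(t), \<dots>\<close> has supremum at most 1 almost surely.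
\<close>

definition max_growth_system ::
    "'a measure \<Rightarrow> ereal measure \<Rightarrow> ereal measure \<Rightarrow> (nat \<Rightarrow> 'a \<Rightarrow> ereal measure) \<Rightarrow> bool" where
  "max_growth_system M F \<nu>\<^sub>0 \<nu> \<longleftrightarrow>
     (\<exists>w :: nat \<Rightarrow> int \<Rightarrow> 'a \<Rightarrow> ereal.
        iid_charges M F ({1..} \<times> UNIV) (\<lambda>(j, t). w j t)
        \<and> (\<forall>\<omega>\<in>space M. \<nu> 0 \<omega> = \<nu>\<^sub>0
             \<and> (\<forall>t. \<nu> (t + 1) \<omega> = mgs_step (\<lambda>j. w j (int t + 1) \<omega>) (\<nu> t \<omega>))))"

section \<open>Maximal charges of paths\<close>

definition paths_to :: "nat \<Rightarrow> nat list set" where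
  "paths_to n = {p. p \<noteq> [] \<and> sorted_wrt (<) p \<and> hd p = 0 \<and> last p = n}"

definition path_charge :: "(nat \<Rightarrow> nat \<Rightarrow> ereal) \<Rightarrow> nat list \<Rightarrow> ereal" where
  "path_charge w p = (\<Sum>k<length p - 1. w (p ! k) (p ! (k + 1)))"

definition maximal_charge :: "(nat \<Rightarrow> nat \<Rightarrow> ereal) \<Rightarrow> nat \<Rightarrow> ereal" where
  "maximal_charge w n = Max (path_charge w ` paths_to n)"

section \<open>Equality in distribution\<close>

definition eq_in_distribution ::
    "'c measure \<Rightarrow> 'a measure \<Rightarrow> ('a \<Rightarrow> 'c) \<Rightarrow> 'b measure \<Rightarrow> ('b \<Rightarrow> 'c) \<Rightarrow> bool" where
  "eq_in_distribution S M X N Y \<longleftrightarrow>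
     X \<in> measurable M S \<and> Y \<in> measurable N S \<and> distr M S X = distr N S Y"

section \<open>Basic facts\<close>

lemma space_point_measure_space: "space point_measure_space = point_measures"
  unfolding point_measure_space_def by (subst space_Sup_eq_UN) auto

lemma emeasure_sum_measure:
  assumes "finite I" and "\<And>i. i \<in> I \<Longrightarrow> sets (\<mu> i) = sets S" and "A \<in> sets S"
  shows "emeasure (sum_measure S I \<mu>) A = (\<Sum>i\<in>I. emeasure (\<mu> i) A)"
proof (rule emeasure_measure_of[OF sum_measure_def])
  show "sets S \<subseteq> Pow (space S)" by (rule sets.space_closed)
  show "A \<in> sets (sum_measure S I \<mu>)" using assms(3) by (simp add: sum_measure_def)
  show "positive (sets (sum_measure S I \<mu>)) (\<lambda>A. \<Sum>i\<in>I. emeasure (\<mu> i) A)"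
    by (simp add: positive_def)
  show "countably_additive (sets (sum_measure S I \<mu>)) (\<lambda>A. \<Sum>i\<in>I. emeasure (\<mu> i) A)"
  proof (rule countably_additiveI)
    fix B :: "nat \<Rightarrow> _ set"
    assume B: "range B \<subseteq> sets (sum_measure S I \<mu>)" "disjoint_family B"
    have "(\<Sum>n. \<Sum>i\<in>I. emeasure (\<mu> i) (B n)) = (\<Sum>i\<in>I. \<Sum>n. emeasure (\<mu> i) (B n))"
      by (rule suminf_sum) simp
    also have "\<dots> = (\<Sum>i\<in>I. emeasure (\<mu> i) (\<Union>n. B n))"
      using B assms(2) by (intro sum.cong refl suminf_emeasure) (auto simp: sum_measure_def)
    finally show "(\<Sum>n. \<Sum>i\<in>I. emeasure (\<mu> i) (B n)) = (\<Sum>i\<in>I. emeasure (\<mu> i) (\<Union>n. B n))" .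
  qed
qed

lemma add_measure_eq_sum_measure:
  "add_measure \<mu> \<nu> = sum_measure \<mu> UNIV (\<lambda>b. if b then \<mu> else \<nu>)"
  unfolding add_measure_def sum_measure_def by (simp add: UNIV_bool add.commute)

lemma emeasure_add_measure:
  assumes "sets \<nu> = sets \<mu>" and "A \<in> sets \<mu>"
  shows "emeasure (add_measure \<mu> \<nu>) A = emeasure \<mu> A + emeasure \<nu> A"
  unfolding add_measure_eq_sum_measure
  using assms by (subst emeasure_sum_measure) (auto simp: UNIV_bool add.commute)

lemma le_kth_atom_iff:
  assumes \<nu>: "\<nu> \<in> point_measures" and k: "of_nat k \<le> emeasure \<nu> (space \<nu>)" and x: "x < \<infinity>"
  shows "x \<le> kth_atom \<nu> k \<longleftrightarrow> of_nat k \<le> emeasure \<nu> {x..<\<infinity>}"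
proof
  assume "of_nat k \<le> emeasure \<nu> {x..<\<infinity>}"
  with x show "x \<le> kth_atom \<nu> k" unfolding kth_atom_def by (intro Sup_upper) auto
next
  assume le: "x \<le> kth_atom \<nu> k"
  have sets: "sets \<nu> = sets charge_space" using \<nu> by (simp add: point_measures_def)
  have space: "space \<nu> = {-\<infinity>..<\<infinity>}" using sets_eq_imp_space_eq[OF sets] by (simp add: space_restrict_space)
  have meas: "{y..<\<infinity>} \<in> sets \<nu>" for y :: ereal
    unfolding sets by (subst sets_restrict_space_iff) auto
  have below: "of_nat k \<le> emeasure \<nu> {y..<\<infinity>}" if "y < x" for y
  proof -
    from that le have "y < kth_atom \<nu> k" by simp
    then obtain z where "y < z" "of_nat k \<le> emeasure \<nu> {z..<\<infinity>}"
      unfolding kth_atom_def less_Sup_iff by auto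
    moreover have "emeasure \<nu> {z..<\<infinity>} \<le> emeasure \<nu> {y..<\<infinity>}"
      using \<open>y < z\<close> by (intro emeasure_mono meas) auto
    ultimately show ?thesis by simp
  qed
  show "of_nat k \<le> emeasure \<nu> {x..<\<infinity>}"
  proof (cases x)
    case (real r)
    define B where "B n = {ereal (r - 1 / real (Suc n))..<\<infinity>}" for n
    have "(\<Inter>n. B n) = {x..<\<infinity>}"
    proof (intro set_eqI iffI)
      fix y assume y: "y \<in> (\<Inter>n. B n)"
      have "x \<le> y"
      proof (rule LIMSEQ_le_const2)
        have "(\<lambda>n. r - 1 / real (Suc n)) \<longlonglongrightarrow> r - 0"
          by (intro tendsto_diff tendsto_const LIMSEQ_Suc[OF lim_1_over_n])
        then show "(\<lambda>n. ereal (r - 1 / real (Suc n))) \<longlonglongrightarrow> x" using real by simp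
        show "\<exists>N. \<forall>n\<ge>N. ereal (r - 1 / real (Suc n)) \<le> y" using y by (auto simp: B_def)
      qed
      with y show "y \<in> {x..<\<infinity>}" by (auto simp: B_def)
    next
      fix y assume "y \<in> {x..<\<infinity>}"
      then show "y \<in> (\<Inter>n. B n)"
        using real by (auto simp: B_def intro: order_trans[rotated])
    qed
    moreover have "(INF n. emeasure \<nu> (B n)) = emeasure \<nu> (\<Inter>n. B n)"
    proof (rule INF_emeasure_decseq)
      show "range B \<subseteq> sets \<nu>" using meas by (auto simp: B_def)
      show "decseq B" unfolding B_def decseq_def
        by (auto simp: frac_le intro: order_trans[rotated])
      show "emeasure \<nu> (B n) \<noteq> \<infinity>" for n
        using \<nu> unfolding point_measures_def B_def by (auto simp: less_top)
    qed
    moreover have "of_nat k \<le> (INF n. emeasure \<nu> (B n))"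
      unfolding B_def using real by (intro INF_greatest below) auto
    ultimately show ?thesis by simp
  qed (use x k space in auto)
qed

lemma finite_paths_to: "finite (paths_to n)"
proof (rule finite_subset)
  show "paths_to n \<subseteq> sorted_list_of_set ` Pow {..n}"
  proof
    fix p assume p: "p \<in> paths_to n"
    then have s: "sorted_wrt (<) p" "p \<noteq> []" "last p = n" by (auto simp: paths_to_def)
    have "x \<le> n" if "x \<in> set p" for x
      using that s by (cases p rule: rev_cases) (auto simp: sorted_wrt_append)
    moreover have "sorted_list_of_set (set p) = p"
      using s(1) by (simp add: strict_sorted_equal)
    ultimately show "p \<in> sorted_list_of_set ` Pow {..n}" by (metis PowI atMost_iff image_eqI subsetI)
  qed
qed simp

lemma paths_to_nonempty: "paths_to n \<noteq> {}"
proof -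
  have "(if n = 0 then [0] else [0, n]) \<in> paths_to n" by (auto simp: paths_to_def)
  then show ?thesis by blast
qed

end

theory Submission
  imports Defs
begin

text \<open>
  Both processes have the form \<open>Y\<^sub>0 = 0\<close>, \<open>Y\<^sub>n\<^sub>+\<^sub>1 = max\<^sub>k (T\<^sub>k + \<xi>\<^sub>n\<^sub>,\<^sub>k)\<close> with fresh i.i.d. charges \<open>\<xi>\<^sub>n\<^sub>,\<^sub>k\<close>, where
  \<open>T\<close> is the sequence \<open>Y\<^sub>0, \<dots>, Y\<^sub>n\<close> itself for the path charges and its decreasing
  rearrangement for the Max Growth System.  Given the past, permuting the fresh charges does not
  change their law, so that the two processes have the same transition kernels.
\<close>

section \<open>Charges and their measurability\<close>

lemma space_charge_space: "space charge_space = {-\<infinity>..<\<infinity>}"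
  by (simp add: space_restrict_space)

lemma in_space_charge_space_iff: "x \<in> space charge_space \<longleftrightarrow> x < \<infinity>"
  by (simp add: space_charge_space)

lemma atLeastLessThan_in_sets_charge_space: "{x..<\<infinity>} \<in> sets charge_space"
  by (subst sets_restrict_space_iff) auto

lemma measurable_charge_spaceI:
  "f \<in> borel_measurable M \<Longrightarrow> (\<And>\<omega>. \<omega> \<in> space M \<Longrightarrow> f \<omega> < \<infinity>) \<Longrightarrow> f \<in> M \<rightarrow>\<^sub>M charge_space"
  by (intro measurable_restrict_space2) auto

lemma measurable_charge_space_borel: "f \<in> M \<rightarrow>\<^sub>M charge_space \<Longrightarrow> f \<in> borel_measurable M"
  by (simp add: measurable_restrict_space2_iff)

text \<open>The value is attained, so a supremum of finitely many charges never reaches \<infinity>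
  and stays in the charge space.\<close>

lemma SUP_lessThan_infinity:
  fixes f :: "'i \<Rightarrow> ereal"
  assumes "finite I" "I \<noteq> {}" and "\<And>i. i \<in> I \<Longrightarrow> f i < \<infinity>"
  shows "(SUP i\<in>I. f i) < \<infinity>"
proof -
  have "(SUP i\<in>I. f i) = Max (f ` I)"
    using assms by (intro cSup_eq_Max) auto
  also have "\<dots> \<in> f ` I"
    using assms by (intro Max_in) auto
  finally show ?thesis using assms(3) by (metis imageE)
qed

section \<open>Growth with rearranged atoms\<close>

text \<open>\<open>T n y\<close> lists the atoms \<open>y 0, ..., y n\<close> in the order in which
  they meet the fresh charges \<open>x 0, ..., x n\<close>. A state is a full sequence so that all
  stages share one state space.\<close>

definition extend ::
    "(nat \<Rightarrow> (nat \<Rightarrow> ereal) \<Rightarrow> nat \<Rightarrow> ereal) \<Rightarrow> nat \<Rightarrow> (nat \<Rightarrow> ereal) \<Rightarrow> (nat \<Rightarrow> ereal) \<Rightarrow> nat \<Rightarrow> ereal" where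
  "extend T n y x = y(Suc n := SUP k\<in>{..n}. T n y k + x k)"

primrec growth ::
    "(nat \<Rightarrow> (nat \<Rightarrow> ereal) \<Rightarrow> nat \<Rightarrow> ereal) \<Rightarrow> (nat \<Rightarrow> nat \<Rightarrow> ereal) \<Rightarrow> nat \<Rightarrow> nat \<Rightarrow> ereal" where
  "growth T \<xi> 0 = (\<lambda>_. 0)"
| "growth T \<xi> (Suc n) = extend T n (growth T \<xi> n) (\<xi> n)"

abbreviation states :: "(nat \<Rightarrow> ereal) measure" where
  "states \<equiv> \<Pi>\<^sub>M i\<in>UNIV. charge_space"

text \<open>The permutation may depend on the state \<open>y\<close>. Measurability is asked of the
  values \<open>T n y k\<close> alone, so no measurable choice of \<open>\<sigma>\<close> has to be
  made.\<close>

definition measurable_rearrangement :: "(nat \<Rightarrow> (nat \<Rightarrow> ereal) \<Rightarrow> nat \<Rightarrow> ereal) \<Rightarrow> bool" where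
  "measurable_rearrangement T \<longleftrightarrow>
     (\<forall>n. \<forall>k\<le>n. (\<lambda>y. T n y k) \<in> states \<rightarrow>\<^sub>M charge_space)
     \<and> (\<forall>n. \<forall>y\<in>space states. \<exists>\<sigma>. \<sigma> permutes {..n} \<and> (\<forall>k\<le>n. T n y k = y (\<sigma> k)))"

text \<open>Each stage writes one new entry and leaves the others alone. The whole trajectory can
  therefore be read off the diagonal \<open>growth T \<xi> t t\<close>.\<close>

lemma growth_stable: "i \<le> m \<Longrightarrow> m \<le> n \<Longrightarrow> growth T \<xi> n i = growth T \<xi> m i"
  by (induction n) (auto simp: extend_def le_Suc_eq)

lemma growth_at_0: "growth T \<xi> n 0 = 0"
  using growth_stable[of 0 0 n T \<xi>] by simp

lemma growth_cong:
  "(\<And>m k. m < n \<Longrightarrow> k \<le> m \<Longrightarrow> \<xi> m k = \<eta> m k) \<Longrightarrow> growth T \<xi> n = growth T \<eta> n"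
  by (induction n) (auto simp: extend_def intro!: SUP_cong arg_cong2[where f = "(+)"])

lemma measurable_extend:
  assumes T: "measurable_rearrangement T"
  shows "(\<lambda>(y, x). extend T n y x) \<in> states \<Otimes>\<^sub>M (\<Pi>\<^sub>M k\<in>{..n}. charge_space) \<rightarrow>\<^sub>M states"
    (is "_ \<in> ?P \<rightarrow>\<^sub>M _")
proof -
  have T': "(\<lambda>p. T n (fst p) k) \<in> ?P \<rightarrow>\<^sub>M charge_space" if "k \<le> n" for k
    using T that unfolding measurable_rearrangement_def
    by (intro measurable_compose[OF measurable_fst]) auto
  have x: "(\<lambda>p. snd p k) \<in> ?P \<rightarrow>\<^sub>M charge_space" if "k \<le> n" for k
    using that by (intro measurable_compose[OF measurable_snd] measurable_component_singleton) auto
  have "(\<lambda>p. SUP k\<in>{..n}. T n (fst p) k + snd p k) \<in> ?P \<rightarrow>\<^sub>M charge_space"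
  proof (rule measurable_charge_spaceI)
    show "(\<lambda>p. SUP k\<in>{..n}. T n (fst p) k + snd p k) \<in> borel_measurable ?P"
      using T' x
      by (intro borel_measurable_SUP borel_measurable_ereal_add)
         (auto intro!: measurable_charge_space_borel)
    show "(SUP k\<in>{..n}. T n (fst p) k + snd p k) < \<infinity>" if "p \<in> space ?P" for p
      using measurable_space[OF T' that] measurable_space[OF x that]
      by (intro SUP_lessThan_infinity) (auto simp: in_space_charge_space_iff)
  qed
  then have "(\<lambda>p. (fst p)(Suc n := SUP k\<in>{..n}. T n (fst p) k + snd p k)) \<in> ?P \<rightarrow>\<^sub>M states"
    by (intro measurable_fun_upd[where J = UNIV]) auto
  then show ?thesis
    by (simp add: extend_def case_prod_beta)
qed

lemma measurable_growth:
  assumes T: "measurable_rearrangement T"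
    and "\<And>m k. m < n \<Longrightarrow> k \<le> m \<Longrightarrow> (\<lambda>\<omega>. \<xi> m k \<omega>) \<in> M \<rightarrow>\<^sub>M charge_space"
  shows "(\<lambda>\<omega>. growth T (\<lambda>m k. \<xi> m k \<omega>) n) \<in> M \<rightarrow>\<^sub>M states"
  using assms(2)
proof (induction n)
  case 0
  show ?case by (auto intro!: measurable_const simp: space_PiM in_space_charge_space_iff)
next
  case (Suc n)
  \<comment> \<open>The step reads only \<open>\<xi> n k\<close> with \<open>k \<le> n\<close>;
    restricting the row to \<open>{..n}\<close> puts it in the product space on which
    \<open>extend\<close> is measurable.\<close>
  have *: "growth T (\<lambda>m k. \<xi> m k \<omega>) (Suc n) =
      (\<lambda>(y, x). extend T n y x) (growth T (\<lambda>m k. \<xi> m k \<omega>) n, \<lambda>k\<in>{..n}. \<xi> n k \<omega>)" for \<omega>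
    by (auto simp: extend_def intro!: SUP_cong)
  show ?case
    unfolding * using Suc
    by (intro measurable_compose[OF _ measurable_extend[OF T]] measurable_Pair measurable_restrict) auto
qed

section \<open>The law of a growth process\<close>

text \<open>The law obtained by iterating the transition kernel, without reference to any underlying
  probability space; the two models are compared through it.\<close>

primrec growth_law ::
    "(nat \<Rightarrow> (nat \<Rightarrow> ereal) \<Rightarrow> nat \<Rightarrow> ereal) \<Rightarrow> ereal measure \<Rightarrow> nat \<Rightarrow> (nat \<Rightarrow> ereal) measure" where
  "growth_law T F 0 = return states (\<lambda>_. 0)"
| "growth_law T F (Suc n) =
     distr (growth_law T F n \<Otimes>\<^sub>M (\<Pi>\<^sub>M k\<in>{..n}. F)) states (\<lambda>(y, x). extend T n y x)"

lemma sets_growth_law: "sets (growth_law T F n) = sets states"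
  by (cases n) auto

text \<open>By injectivity the singletons \<open>{e l}\<close> are disjoint blocks of indices, so
  the restrictions to them are independent; each is then read at its only coordinate.\<close>

lemma (in prob_space) indep_vars_reindex:
  assumes ind: "indep_vars (\<lambda>_. S) X I" and e: "inj_on e L" "e \<in> L \<rightarrow> I"
  shows "indep_vars (\<lambda>_. S) (\<lambda>l. X (e l)) L"
proof -
  have "indep_vars (\<lambda>l. PiM {e l} (\<lambda>_. S)) (\<lambda>l \<omega>. restrict (\<lambda>i. X i \<omega>) {e l}) L"
    using e by (intro indep_vars_restrict[OF ind])
      (auto simp: disjoint_family_on_def inj_on_def)
  then have "indep_vars (\<lambda>_. S) (\<lambda>l \<omega>. (restrict (\<lambda>i. X i \<omega>) {e l}) (e l)) L"
    by (rule indep_vars_compose2) (auto intro!: measurable_component_singleton)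
  then show ?thesis by simp
qed

text \<open>The map \<open>e\<close> places the triangle of charges \<open>\<xi> m k\<close>,
  \<open>k \<le> m\<close>, inside the index set of a given i.i.d. family. Row \<open>n\<close> is
  independent of the rows below it, which determine the state at stage \<open>n\<close>, so the
  joint law of state and row is the product that defines the next \<open>growth_law\<close>.\<close>

lemma distr_growth:
  assumes T: "measurable_rearrangement T"
    and iid: "iid_charges M F I X"
    and e: "inj_on e {(n, k). k \<le> n}" "e \<in> {(n, k). k \<le> n} \<rightarrow> I"
  shows "distr M states (\<lambda>\<omega>. growth T (\<lambda>m k. X (e (m, k)) \<omega>) n) = growth_law T F n"
proof (induction n)
  case 0
  interpret prob_space M using iid by (simp add: iid_charges_def)
  have "(\<lambda>_. 0) \<in> space states" by (auto simp: space_PiM in_space_charge_space_iff)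
  then show ?case by (simp add: distr_const)
next
  case (Suc n)
  interpret prob_space M using iid by (simp add: iid_charges_def)
  define \<xi> where "\<xi> m k = X (e (m, k))" for m k
  have "indep_vars (\<lambda>_. charge_space) (\<lambda>l. X (e l)) {(n, k). k \<le> n}"
    using iid by (intro indep_vars_reindex[OF _ e]) (simp add: iid_charges_def)
  also have "(\<lambda>l. X (e l)) = (\<lambda>(m, k). \<xi> m k)"
    by (auto simp: \<xi>_def)
  finally have ind: "indep_vars (\<lambda>_. charge_space) (\<lambda>(m, k). \<xi> m k) {(n, k). k \<le> n}" .
  have \<xi>_meas: "\<xi> m k \<in> M \<rightarrow>\<^sub>M charge_space" if "k \<le> m" for m k
    using ind that by (auto simp: indep_vars_def)
  have \<xi>_law: "distr M charge_space (\<xi> m k) = F" if "k \<le> m" for m k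
    using iid e that by (auto simp: iid_charges_def \<xi>_def)
  \<comment> \<open>\<open>A\<close> indexes the charges consumed before stage \<open>n\<close>,
    \<open>B\<close> those consumed by the step from \<open>n\<close> to \<open>Suc n\<close>; they
    are disjoint.\<close>
  define A B where "A = {(m, k). m < n \<and> k \<le> m}" and "B = {n} \<times> {..n}"
  define G where "G z = growth T (\<lambda>m k. z (m, k)) n" for z :: "nat \<times> nat \<Rightarrow> ereal"
  define H where "H z = (\<lambda>k\<in>{..n}. z (n, k))" for z :: "nat \<times> nat \<Rightarrow> ereal"
  have "indep_var (\<Pi>\<^sub>M i\<in>A. charge_space) (\<lambda>\<omega>. restrict (\<lambda>i. (\<lambda>(m, k). \<xi> m k) i \<omega>) A)
      (\<Pi>\<^sub>M i\<in>B. charge_space) (\<lambda>\<omega>. restrict (\<lambda>i. (\<lambda>(m, k). \<xi> m k) i \<omega>) B)"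
    by (rule indep_var_restrict[OF ind]) (auto simp: A_def B_def)
  moreover have "G \<in> (\<Pi>\<^sub>M i\<in>A. charge_space) \<rightarrow>\<^sub>M states"
    unfolding G_def
    by (intro measurable_growth[OF T] measurable_component_singleton) (auto simp: A_def)
  moreover have "H \<in> (\<Pi>\<^sub>M i\<in>B. charge_space) \<rightarrow>\<^sub>M (\<Pi>\<^sub>M k\<in>{..n}. charge_space)"
    unfolding H_def
    by (intro measurable_restrict measurable_component_singleton) (auto simp: B_def)
  ultimately have "indep_var states (G \<circ> (\<lambda>\<omega>. restrict (\<lambda>i. (\<lambda>(m, k). \<xi> m k) i \<omega>) A))
      (\<Pi>\<^sub>M k\<in>{..n}. charge_space) (H \<circ> (\<lambda>\<omega>. restrict (\<lambda>i. (\<lambda>(m, k). \<xi> m k) i \<omega>) B))"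
    by (rule indep_var_compose)
  also have "G \<circ> (\<lambda>\<omega>. restrict (\<lambda>i. (\<lambda>(m, k). \<xi> m k) i \<omega>) A) = (\<lambda>\<omega>. growth T (\<lambda>m k. \<xi> m k \<omega>) n)"
    by (auto simp: G_def A_def fun_eq_iff intro!: arg_cong[OF growth_cong, where f = "\<lambda>f. f _"])
  also have "H \<circ> (\<lambda>\<omega>. restrict (\<lambda>i. (\<lambda>(m, k). \<xi> m k) i \<omega>) B) = (\<lambda>\<omega>. \<lambda>k\<in>{..n}. \<xi> n k \<omega>)"
    by (auto simp: H_def B_def fun_eq_iff)
  finally have pair:
    "indep_var states (\<lambda>\<omega>. growth T (\<lambda>m k. \<xi> m k \<omega>) n)
       (\<Pi>\<^sub>M k\<in>{..n}. charge_space) (\<lambda>\<omega>. \<lambda>k\<in>{..n}. \<xi> n k \<omega>)" .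
  have "indep_vars (\<lambda>_. charge_space) (\<lambda>k. (\<lambda>(m, k). \<xi> m k) (n, k)) {..n}"
    by (rule indep_vars_reindex[OF ind]) (auto simp: inj_on_def)
  then have "distr M (\<Pi>\<^sub>M k\<in>{..n}. charge_space) (\<lambda>\<omega>. \<lambda>k\<in>{..n}. \<xi> n k \<omega>) =
      (\<Pi>\<^sub>M k\<in>{..n}. distr M charge_space (\<xi> n k))"
    using \<xi>_meas by (subst (asm) indep_vars_iff_distr_eq_PiM') auto
  also have "\<dots> = (\<Pi>\<^sub>M k\<in>{..n}. F)"
    using \<xi>_law by (intro PiM_cong) auto
  finally have fresh: "distr M (\<Pi>\<^sub>M k\<in>{..n}. charge_space) (\<lambda>\<omega>. \<lambda>k\<in>{..n}. \<xi> n k \<omega>) = (\<Pi>\<^sub>M k\<in>{..n}. F)" .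
  have "growth_law T F (Suc n) =
      distr (distr M (states \<Otimes>\<^sub>M (\<Pi>\<^sub>M k\<in>{..n}. charge_space))
        (\<lambda>\<omega>. (growth T (\<lambda>m k. \<xi> m k \<omega>) n, \<lambda>k\<in>{..n}. \<xi> n k \<omega>))) states (\<lambda>(y, x). extend T n y x)"
    using pair Suc fresh unfolding indep_var_distribution_eq by (simp add: \<xi>_def)
  also have "\<dots> = distr M states (\<lambda>\<omega>. extend T n (growth T (\<lambda>m k. \<xi> m k \<omega>) n) (\<lambda>k\<in>{..n}. \<xi> n k \<omega>))"
    using pair unfolding indep_var_distribution_eq
    by (subst distr_distr[OF measurable_extend[OF T]]) (auto simp: comp_def)
  also have "\<dots> = distr M states (\<lambda>\<omega>. growth T (\<lambda>m k. \<xi> m k \<omega>) (Suc n))"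
    by (intro distr_cong refl) (auto simp: extend_def intro!: SUP_cong)
  finally show ?case by (simp add: \<xi>_def)
qed

text \<open>Permuting the fresh charges turns the rearranged atoms back into the original ones.\<close>

lemma emeasure_extend_rearranged:
  assumes F: "prob_space F" "sets F = sets charge_space"
    and T: "measurable_rearrangement T"
    and y: "y \<in> space states" and A: "A \<in> sets states"
  shows "emeasure (\<Pi>\<^sub>M k\<in>{..n}. F) (Pair y -` ((\<lambda>(y, x). extend T n y x) -` A \<inter> (space states \<times> space (\<Pi>\<^sub>M k\<in>{..n}. F))))
       = emeasure (\<Pi>\<^sub>M k\<in>{..n}. F) (Pair y -` ((\<lambda>(y, x). extend (\<lambda>n y. y) n y x) -` A \<inter> (space states \<times> space (\<Pi>\<^sub>M k\<in>{..n}. F))))"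
proof -
  let ?P = "\<Pi>\<^sub>M k\<in>{..n}. F"
  obtain \<sigma> where \<sigma>: "\<sigma> permutes {..n}" "\<And>k. k \<le> n \<Longrightarrow> T n y k = y (\<sigma> k)"
    using T y unfolding measurable_rearrangement_def by blast
  \<comment> \<open>The charges are reindexed by the same \<open>\<sigma>\<close> as the atoms:
    \<open>y (\<sigma> k)\<close> then meets \<open>x (\<sigma> k)\<close>, and the supremum over
    \<open>k\<close> is the unrearranged one. Since all factors equal \<open>F\<close>,
    \<open>f\<close> preserves the product law.\<close>
  define f where "f x = (\<lambda>k\<in>{..n}. x (\<sigma> k))" for x :: "nat \<Rightarrow> ereal"
  have \<sigma>_le: "\<sigma> k \<le> n \<longleftrightarrow> k \<le> n" for k
    using permutes_in_image[OF \<sigma>(1)] by simp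
  have f: "f \<in> ?P \<rightarrow>\<^sub>M ?P"
    unfolding f_def using \<sigma>_le
    by (intro measurable_restrict measurable_component_singleton) auto
  have law: "distr ?P ?P f = ?P"
    unfolding f_def using F(1) \<sigma>_le
    by (intro distr_PiM_reindex[where M = "\<lambda>_. F"]) (auto intro: permutes_inj_on[OF \<sigma>(1)])
  have ext: "extend T n y (f x) = extend (\<lambda>n y. y) n y x" for x
  proof -
    have "(SUP k\<in>{..n}. T n y k + f x k) = (SUP k\<in>{..n}. (\<lambda>k. y k + x k) (\<sigma> k))"
      by (intro SUP_cong) (auto simp: f_def \<sigma>)
    also have "\<dots> = (SUP k\<in>\<sigma> ` {..n}. y k + x k)"
      by (simp add: image_image)
    finally show ?thesis by (simp add: extend_def permutes_image[OF \<sigma>(1)])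
  qed
  let ?S = "{x \<in> space ?P. extend T n y x \<in> A}"
  have "(\<lambda>x. extend T n y x) \<in> ?P \<rightarrow>\<^sub>M states"
  proof -
    have "(\<lambda>x. (\<lambda>(y, x). extend T n y x) (y, x)) \<in> (\<Pi>\<^sub>M k\<in>{..n}. charge_space) \<rightarrow>\<^sub>M states"
      using y by (intro measurable_compose[OF _ measurable_extend[OF T]] measurable_Pair1')
    moreover have "sets ?P = sets (\<Pi>\<^sub>M k\<in>{..n}. charge_space)"
      using F(2) by (intro sets_PiM_cong) auto
    ultimately show ?thesis
      by (simp add: measurable_cong_sets[where M = ?P])
  qed
  then have S: "?S \<in> sets ?P"
    using measurable_sets[OF _ A, of "extend T n y" ?P] by (simp add: vimage_def Int_def conj_commute)
  have "emeasure ?P ?S = emeasure (distr ?P ?P f) ?S"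
    by (simp add: law)
  also have "\<dots> = emeasure ?P (f -` ?S \<inter> space ?P)"
    using f S by (rule emeasure_distr)
  also have "f -` ?S \<inter> space ?P = {x \<in> space ?P. extend (\<lambda>n y. y) n y x \<in> A}"
    using measurable_space[OF f] by (auto simp: ext)
  finally show ?thesis using y by (simp add: vimage_def Collect_conj_eq Int_commute)
qed

lemma measurable_rearrangement_id: "measurable_rearrangement (\<lambda>n y. y)"
  unfolding measurable_rearrangement_def
  by (auto intro!: measurable_component_singleton exI[of _ id] permutes_id)

text \<open>Induction on the stage: the laws of the current state agree, and from each fixed state
  both rules have the same transition probabilities. The state has to be fixed first because the
  permutation depends on it.\<close>

lemma growth_law_rearranged:
  assumes F: "prob_space F" "sets F = sets charge_space" and T: "measurable_rearrangement T"
  shows "growth_law T F n = growth_law (\<lambda>n y. y) F n"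
proof (induction n)
  case 0
  show ?case by simp
next
  case (Suc n)
  let ?U = "\<lambda>n y. y" and ?P = "\<Pi>\<^sub>M k\<in>{..n}. F" and ?L = "growth_law (\<lambda>n y. y) F n"
  interpret P: prob_space ?P using F by (intro prob_space_PiM)
  have sets: "sets (?L \<Otimes>\<^sub>M ?P) = sets (states \<Otimes>\<^sub>M (\<Pi>\<^sub>M k\<in>{..n}. charge_space))"
    using F by (intro sets_pair_measure_cong sets_growth_law sets_PiM_cong) auto
  have space_L: "space ?L = space states"
    using sets_growth_law by (rule sets_eq_imp_space_eq)
  have meas: "(\<lambda>(y, x). extend V n y x) \<in> ?L \<Otimes>\<^sub>M ?P \<rightarrow>\<^sub>M states" if "measurable_rearrangement V" for V
    using measurable_extend[OF that, of n] by (simp add: measurable_cong_sets[OF sets refl])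
  \<comment> \<open>The law of the next state is an integral over \<open>y\<close> of the measures
    of sections; inside a section \<open>y\<close> is frozen, so a single permutation
    applies.\<close>
  have step: "emeasure (distr (?L \<Otimes>\<^sub>M ?P) states (\<lambda>(y, x). extend V n y x)) A =
      (\<integral>\<^sup>+y. emeasure ?P (Pair y -` ((\<lambda>(y, x). extend V n y x) -` A \<inter> (space states \<times> space ?P))) \<partial>?L)"
    if V: "measurable_rearrangement V" and A: "A \<in> sets states" for V A
  proof -
    have "emeasure (distr (?L \<Otimes>\<^sub>M ?P) states (\<lambda>(y, x). extend V n y x)) A =
        emeasure (?L \<Otimes>\<^sub>M ?P) ((\<lambda>(y, x). extend V n y x) -` A \<inter> space (?L \<Otimes>\<^sub>M ?P))"
      by (rule emeasure_distr[OF meas[OF V] A])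
    also have "\<dots> = (\<integral>\<^sup>+y. emeasure ?P (Pair y -` ((\<lambda>(y, x). extend V n y x) -` A \<inter> space (?L \<Otimes>\<^sub>M ?P))) \<partial>?L)"
      by (rule P.emeasure_pair_measure_alt) (rule measurable_sets[OF meas[OF V] A])
    finally show ?thesis by (simp add: space_pair_measure space_L)
  qed
  show ?case
  proof (rule measure_eqI)
    fix A assume "A \<in> sets (growth_law T F (Suc n))"
    then have A: "A \<in> sets states" by (simp add: sets_growth_law)
    show "emeasure (growth_law T F (Suc n)) A = emeasure (growth_law ?U F (Suc n)) A"
      unfolding growth_law.simps Suc step[OF T A] step[OF measurable_rearrangement_id A]
      by (intro nn_integral_cong emeasure_extend_rearranged F T A)
         (simp add: space_L)
  qed simp
qed

section \<open>Law of the whole trajectory of a growth process\<close>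

lemma measurable_growth_process:
  assumes T: "measurable_rearrangement T" and iid: "iid_charges M F I X"
    and e: "e \<in> {(n, k). k \<le> n} \<rightarrow> I"
  shows "(\<lambda>\<omega>. growth T (\<lambda>m k. X (e (m, k)) \<omega>) n) \<in> M \<rightarrow>\<^sub>M states" (is "?g n \<in> _")
    and "(\<lambda>\<omega> t. growth T (\<lambda>m k. X (e (m, k)) \<omega>) t t) \<in> M \<rightarrow>\<^sub>M states"
proof -
  interpret prob_space M using iid by (simp add: iid_charges_def)
  have X: "X (e (m, k)) \<in> M \<rightarrow>\<^sub>M charge_space" if "k \<le> m" for m k
    using iid that e by (auto simp: iid_charges_def indep_vars_def)
  show g: "?g n \<in> M \<rightarrow>\<^sub>M states" for n
    using X by (intro measurable_growth[OF T]) auto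
  have "(\<lambda>\<omega>. ?g t \<omega> t) \<in> M \<rightarrow>\<^sub>M charge_space" for t
    by (intro measurable_compose[OF g] measurable_component_singleton) auto
  then show "(\<lambda>\<omega> t. ?g t \<omega> t) \<in> M \<rightarrow>\<^sub>M states"
    by (intro measurable_PiM_single') (auto simp: measurable_def)
qed

text \<open>The entries with index in \<open>J\<close> are final by stage \<open>n\<close>, so on
  this cylinder the trajectory and the state at stage \<open>n\<close> cannot be told apart.\<close>

lemma emeasure_growth_process_cylinder:
  assumes T: "measurable_rearrangement T" and iid: "iid_charges M F I X"
    and e: "inj_on e {(n, k). k \<le> n}" "e \<in> {(n, k). k \<le> n} \<rightarrow> I"
    and J: "J \<subseteq> {..n}" and A: "\<And>i. i \<in> J \<Longrightarrow> A i \<in> sets charge_space"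
  shows "emeasure (distr M states (\<lambda>\<omega> t. growth T (\<lambda>m k. X (e (m, k)) \<omega>) t t))
           (prod_emb UNIV (\<lambda>_. charge_space) J (Pi\<^sub>E J A)) =
         emeasure (growth_law T F n) (prod_emb UNIV (\<lambda>_. charge_space) J (Pi\<^sub>E J A))"
    (is "emeasure (distr M states ?Y) ?E = _")
proof -
  let ?g = "\<lambda>\<omega>. growth T (\<lambda>m k. X (e (m, k)) \<omega>) n"
  have E: "?E \<in> sets states"
    using J A by (intro sets_PiM_I) (auto intro: finite_subset)
  have E_iff: "y \<in> ?E \<longleftrightarrow> (\<forall>i\<in>J. y i \<in> A i)" if "y \<in> space states" for y
    using that by (auto simp: prod_emb_def space_PiM)
  note meas = measurable_growth_process[OF T iid e(2)]
  have "?Y \<omega> i = ?g \<omega> i" if "i \<in> J" for \<omega> i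
    using growth_stable[of i i n] J that by auto
  then have "?Y -` ?E \<inter> space M = ?g -` ?E \<inter> space M"
    using measurable_space[OF meas(1)[of n]] measurable_space[OF meas(2)] by (auto simp: E_iff)
  then have "emeasure (distr M states ?Y) ?E = emeasure (distr M states ?g) ?E"
    using E meas by (simp add: emeasure_distr)
  then show ?thesis by (simp only: distr_growth[OF T iid e])
qed

text \<open>Finite measures on the infinite product are determined by cylinders with finite base.
  Every base lies in some \<open>{..n}\<close>, where both sides reduce to laws of stage
  \<open>n\<close>.\<close>

lemma distr_growth_process_eq:
  assumes F: "prob_space F" "sets F = sets charge_space" and T: "measurable_rearrangement T"
    and iid: "iid_charges M F I X" "iid_charges N F J Z"
    and e: "inj_on e {(n, k). k \<le> n}" "e \<in> {(n, k). k \<le> n} \<rightarrow> I"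
    and d: "inj_on d {(n, k). k \<le> n}" "d \<in> {(n, k). k \<le> n} \<rightarrow> J"
  shows "distr M states (\<lambda>\<omega> t. growth T (\<lambda>m k. X (e (m, k)) \<omega>) t t) =
         distr N states (\<lambda>\<omega> t. growth (\<lambda>n y. y) (\<lambda>m k. Z (d (m, k)) \<omega>) t t)"
proof (rule measure_eqI_PiM_infinite)
  interpret prob_space M using iid by (simp add: iid_charges_def)
  show "finite_measure (distr M states (\<lambda>\<omega> t. growth T (\<lambda>m k. X (e (m, k)) \<omega>) t t))"
    by (intro finite_measure_distr measurable_growth_process(2)[OF T iid(1) e(2)])
  fix A and K :: "nat set"
  assume K: "finite K" and A: "\<And>i. i \<in> K \<Longrightarrow> A i \<in> sets charge_space"
  obtain n where n: "K \<subseteq> {..n}"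
    using K by (auto simp: finite_nat_set_iff_bounded_le)
  show "emeasure (distr M states (\<lambda>\<omega> t. growth T (\<lambda>m k. X (e (m, k)) \<omega>) t t))
          (prod_emb UNIV (\<lambda>_. charge_space) K (Pi\<^sub>E K A)) =
        emeasure (distr N states (\<lambda>\<omega> t. growth (\<lambda>n y. y) (\<lambda>m k. Z (d (m, k)) \<omega>) t t))
          (prod_emb UNIV (\<lambda>_. charge_space) K (Pi\<^sub>E K A))"
    using emeasure_growth_process_cylinder[OF T iid(1) e n A]
      emeasure_growth_process_cylinder[OF measurable_rearrangement_id iid(2) d n A]
      growth_law_rearranged[OF F T, of n] by simp
qed simp_all

section \<open>The Max Growth System as a growth process\<close>

definition atoms :: "nat \<Rightarrow> (nat \<Rightarrow> ereal) \<Rightarrow> ereal measure" where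
  "atoms n y = sum_measure charge_space {0..n} (\<lambda>j. return charge_space (y j))"

lemma sets_atoms: "sets (atoms n y) = sets charge_space"
  unfolding atoms_def sum_measure_def by (rule sets.sets_measure_of_eq)

lemma space_atoms: "space (atoms n y) = space charge_space"
  using sets_atoms by (rule sets_eq_imp_space_eq)

lemma emeasure_atoms_sum:
  "A \<in> sets charge_space \<Longrightarrow> emeasure (atoms n y) A = (\<Sum>j\<in>{0..n}. indicator A (y j))"
  unfolding atoms_def by (subst emeasure_sum_measure) auto

lemma emeasure_atoms:
  assumes "A \<in> sets charge_space"
  shows "emeasure (atoms n y) A = of_nat (card {j. j \<le> n \<and> y j \<in> A})"
proof -
  have "emeasure (atoms n y) A = (\<Sum>j\<in>{0..n}. of_bool (y j \<in> A))"
    using assms by (simp add: emeasure_atoms_sum indicator_def)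
  also have "\<dots> = of_nat (card ({0..n} \<inter> {j. y j \<in> A}))"
    by (subst sum_of_bool_eq) simp_all
  also have "{0..n} \<inter> {j. y j \<in> A} = {j. j \<le> n \<and> y j \<in> A}"
    by auto
  finally show ?thesis .
qed

lemma measurable_emeasure_atoms:
  assumes "A \<in> sets charge_space"
  shows "(\<lambda>y. emeasure (atoms n y) A) \<in> borel_measurable states"
  unfolding emeasure_atoms_sum[OF assms]
  by (intro borel_measurable_sum measurable_compose[OF measurable_component_singleton]
      borel_measurable_indicator assms) auto

text \<open>The atom at 0 keeps the largest atom away from -\<infinity>, so the maximum of the
  finitely many locations is a real number.\<close>

lemma atoms_in_point_measures:
  assumes "y 0 = 0" and fin: "\<And>j. y j < \<infinity>"
  shows "atoms n y \<in> point_measures"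
proof -
  define m where "m = Max (y ` {..n})"
  have "m \<in> y ` {..n}" unfolding m_def by (intro Max_in) auto
  then obtain i where i: "i \<le> n" "m = y i" by auto
  have le: "y j \<le> m" if "j \<le> n" for j unfolding m_def using that by (intro Max_ge) auto
  have "0 \<le> m" using le[of 0] assms(1) by simp
  moreover have "m < \<infinity>" using fin i by simp
  ultimately obtain x where x: "m = ereal x" by (cases m) auto
  have "{ereal x} \<in> sets charge_space" "{ereal x<..<\<infinity>} \<in> sets charge_space"
    by (auto simp: sets_restrict_space_iff)
  moreover have "{j. j \<le> n \<and> y j = ereal x} \<noteq> {}" using i x by auto
  moreover have "{j. j \<le> n \<and> ereal x < y j \<and> y j < \<infinity>} = {}"
    using le x by (auto simp: not_less[symmetric])
  ultimately have "emeasure (atoms n y) {ereal x} \<noteq> 0" "emeasure (atoms n y) {ereal x<..<\<infinity>} = 0"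
    by (auto simp: emeasure_atoms)
  then show ?thesis
    unfolding point_measures_def
    by (auto simp: sets_atoms emeasure_atoms atLeastLessThan_in_sets_charge_space of_nat_less_top)
qed

section \<open>Decreasing rearrangement of the atoms\<close>

definition decreasing :: "nat \<Rightarrow> (nat \<Rightarrow> ereal) \<Rightarrow> ereal list" where
  "decreasing n y = rev (sort (map y [0..<Suc n]))"

text \<open>The rearrangement that the Max Growth System uses, read from the measure itself. The
  shift by one is there because \<open>kth_atom\<close> counts from 1 and growth processes count
  from 0.\<close>

definition rank :: "nat \<Rightarrow> (nat \<Rightarrow> ereal) \<Rightarrow> nat \<Rightarrow> ereal" where
  "rank n y k = kth_atom (atoms n y) (Suc k)"

lemma length_decreasing: "length (decreasing n y) = Suc n"
  by (simp add: decreasing_def)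

text \<open>In a nonincreasing list the entries that are at least \<open>z\<close> form an initial
  segment, and entry \<open>k\<close> belongs to it exactly when its length exceeds
  \<open>k\<close>.\<close>

lemma Suc_le_length_filter_iff:
  fixes z :: "'a::linorder"
  assumes "sorted_wrt (\<ge>) xs" "k < length xs"
  shows "Suc k \<le> length (filter (\<lambda>x. z \<le> x) xs) \<longleftrightarrow> z \<le> xs ! k"
  using assms
proof (induction xs arbitrary: k)
  case (Cons a xs)
  show ?case
  proof (cases "z \<le> a")
    case True
    then show ?thesis using Cons by (cases k) auto
  next
    case False
    then have "\<not> z \<le> x" if "x \<in> set (a # xs)" for x
      using that Cons.prems(1) by auto
    then show ?thesis using Cons.prems(2) by (metis filter_False le_zero_eq list.size(3) nat.distinct(2) nth_mem)
  qed
qed simp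

text \<open>Sorting preserves the multiset of values, so counting the entries above \<open>z\<close>
  in the sorted list gives the mass of \<open>{z..<\<infinity>}\<close>.\<close>

lemma le_decreasing_iff:
  assumes "k \<le> n" "\<And>j. y j < \<infinity>"
  shows "z \<le> decreasing n y ! k \<longleftrightarrow> of_nat (Suc k) \<le> emeasure (atoms n y) {z..<\<infinity>}"
proof -
  have "mset (decreasing n y) = mset (map y [0..<Suc n])"
    unfolding decreasing_def by simp
  then have "length (filter (\<lambda>x. z \<le> x) (decreasing n y)) = length (filter (\<lambda>x. z \<le> x) (map y [0..<Suc n]))"
    by (metis mset_filter size_mset)
  also have "\<dots> = card {j. j \<le> n \<and> z \<le> y j}"
    unfolding length_filter_conv_card by (intro arg_cong[where f = card]) (auto simp del: upt_Suc)
  also have "\<dots> = card {j. j \<le> n \<and> y j \<in> {z..<\<infinity>}}"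
    using assms(2) by simp
  finally have "emeasure (atoms n y) {z..<\<infinity>} = of_nat (length (filter (\<lambda>x. z \<le> x) (decreasing n y)))"
    by (simp add: emeasure_atoms atLeastLessThan_in_sets_charge_space)
  moreover have "sorted_wrt (\<ge>) (decreasing n y)"
    unfolding decreasing_def sorted_wrt_rev by (simp del: upt_Suc)
  ultimately show ?thesis
    using Suc_le_length_filter_iff[of "decreasing n y" k z] assms(1)
    by (simp only: of_nat_le_iff) (simp add: length_decreasing)
qed

lemma decreasing_permutes:
  obtains \<sigma> where "\<sigma> permutes {..n}" "\<And>k. k \<le> n \<Longrightarrow> decreasing n y ! k = y (\<sigma> k)"
proof -
  have "mset (decreasing n y) = mset (map y [0..<Suc n])"
    unfolding decreasing_def by simp
  then obtain p where p: "p permutes {..<length (map y [0..<Suc n])}"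
      "permute_list p (map y [0..<Suc n]) = decreasing n y"
    by (rule mset_eq_permutation)
  have perm: "p permutes {..n}"
    using p(1) by (simp add: lessThan_Suc_atMost)
  have "decreasing n y ! k = y (p k)" if "k \<le> n" for k
    unfolding p(2)[symmetric]
    using that permutes_in_image[OF perm, of k]
    by (subst permute_list_nth[OF p(1)]) (auto simp del: upt_Suc)
  with perm show ?thesis using that by blast
qed

lemma rank_eq_decreasing:
  assumes "k \<le> n" and fin: "\<And>j. y j < \<infinity>"
  shows "rank n y k = decreasing n y ! k"
proof -
  let ?d = "decreasing n y ! k"
  have d: "?d < \<infinity>"
    using decreasing_permutes[of n y] assms by metis
  \<comment> \<open>The set whose supremum defines \<open>kth_atom\<close> is a closed initial
    segment; its upper end \<open>?d\<close> is one of the atoms, hence below \<infinity>.\<close>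
  have "{x. x < \<infinity> \<and> of_nat (Suc k) \<le> emeasure (atoms n y) {x..<\<infinity>}} = {..?d}"
    using d by (auto simp only: le_decreasing_iff[OF assms, symmetric] intro: le_less_trans)
  then show ?thesis by (simp add: rank_def kth_atom_def)
qed

lemma measurable_rearrangement_rank: "measurable_rearrangement rank"
  unfolding measurable_rearrangement_def
proof (intro conjI allI impI ballI)
  have fin: "y j < \<infinity>" if "y \<in> space states" for y j
    using that by (auto simp: space_PiM)
  show "\<exists>\<sigma>. \<sigma> permutes {..n} \<and> (\<forall>k\<le>n. rank n y k = y (\<sigma> k))" if "y \<in> space states" for n y
    by (rule decreasing_permutes[of n y]) (use rank_eq_decreasing fin[OF that] in force)
  fix n k :: nat assume k: "k \<le> n"
  show "(\<lambda>y. rank n y k) \<in> states \<rightarrow>\<^sub>M charge_space"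
  proof (rule measurable_charge_spaceI)
    show "rank n y k < \<infinity>" if "y \<in> space states" for y
      using decreasing_permutes[of n y] rank_eq_decreasing[OF k, of y] fin[OF that] k by metis
    show "(\<lambda>y. rank n y k) \<in> borel_measurable states"
    proof (rule borel_measurableI_ge)
      fix z :: ereal
      \<comment> \<open>Measurability of order statistics through counting: the \<open>k\<close>-th
        rank is at least \<open>z\<close> iff at least \<open>k + 1\<close> atoms lie in
        \<open>{z..<\<infinity>}\<close>.\<close>
      have "{y \<in> space states. z \<le> rank n y k} =
          {y \<in> space states. of_nat (Suc k) \<le> emeasure (atoms n y) {z..<\<infinity>}}"
        using k fin by (intro Collect_cong conj_cong refl) (simp add: rank_eq_decreasing le_decreasing_iff del: of_nat_Suc)
      also have "\<dots> \<in> sets states"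
        by (intro borel_measurable_le measurable_emeasure_atoms
            atLeastLessThan_in_sets_charge_space borel_measurable_const)
      finally show "{y \<in> space states. z \<le> rank n y k} \<in> sets states" .
    qed
  qed
qed

text \<open>\<open>atoms n y\<close> has total mass \<open>n + 1\<close>, so the positions 1 to
  \<open>n + 1\<close> compete and are matched with \<open>k \<le> n\<close> by \<open>Suc\<close>.
  The winner is stored as entry \<open>Suc n\<close>, which adds one point mass and leaves the older
  atoms unchanged.\<close>

lemma mgs_step_atoms:
  assumes fin: "\<And>j. y j < \<infinity>"
  shows "mgs_step w (atoms n y) = atoms (Suc n) (extend rank n y (\<lambda>k. w (Suc k)))"
proof -
  have "emeasure (atoms n y) (space charge_space) = of_nat (card {j. j \<le> n})"
    using fin by (subst emeasure_atoms[OF sets.top]) (simp add: space_charge_space)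
  then have "{k. 1 \<le> k \<and> of_nat k \<le> emeasure (atoms n y) (space (atoms n y))} = {k. 1 \<le> k \<and> k \<le> Suc n}"
    unfolding space_atoms by (simp only: of_nat_le_iff card_Collect_le_nat)
  also have "\<dots> = Suc ` {..n}"
    by (auto simp: image_Suc_atMost)
  finally have m: "max_charge_position (atoms n y) w = (SUP k\<in>{..n}. rank n y k + w (Suc k))"
    by (simp add: max_charge_position_def rank_def image_image)
  have sets_step: "sets (mgs_step w (atoms n y)) = sets charge_space"
    unfolding mgs_step_def add_measure_def sets.sets_measure_of_eq by (rule sets_atoms)
  show ?thesis
  proof (rule measure_eqI)
    show "sets (mgs_step w (atoms n y)) = sets (atoms (Suc n) (extend rank n y (\<lambda>k. w (Suc k))))"
      by (simp add: sets_step sets_atoms)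
    fix A assume "A \<in> sets (mgs_step w (atoms n y))"
    then have A: "A \<in> sets charge_space"
      by (simp add: sets_step sets_atoms)
    have "emeasure (mgs_step w (atoms n y)) A =
        emeasure (atoms n y) A + indicator A (SUP k\<in>{..n}. rank n y k + w (Suc k))"
      using A unfolding mgs_step_def
      by (subst emeasure_add_measure) (auto simp: sets_atoms m)
    also have "\<dots> = emeasure (atoms (Suc n) (extend rank n y (\<lambda>k. w (Suc k)))) A"
      using A by (simp add: emeasure_atoms_sum extend_def atLeast0AtMost)
    finally show "emeasure (mgs_step w (atoms n y)) A =
        emeasure (atoms (Suc n) (extend rank n y (\<lambda>k. w (Suc k)))) A" .
  qed
qed

section \<open>Maximal path charges as a growth process\<close>

lemma paths_to_0: "paths_to 0 = {[0]}"
proof -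
  have "p = [0]" if "p \<in> paths_to 0" for p
  proof (cases p)
    case (Cons a q)
    with that show ?thesis by (cases q rule: rev_cases) (auto simp: paths_to_def)
  qed (use that in \<open>simp add: paths_to_def\<close>)
  then show ?thesis by (auto simp: paths_to_def)
qed

text \<open>Paths are sorted by their last vertex \<open>j\<close> before \<open>Suc n\<close>;
  removing the final edge leaves a path to \<open>j\<close>.\<close>

lemma paths_to_Suc: "paths_to (Suc n) = (\<Union>j\<in>{..n}. (\<lambda>p. p @ [Suc n]) ` paths_to j)"
proof (intro equalityI subsetI)
  fix p assume p: "p \<in> paths_to (Suc n)"
  then have "p = butlast p @ [Suc n]"
    by (auto simp: paths_to_def dest: append_butlast_last_id)
  then obtain q where q: "p = q @ [Suc n]" by blast
  with p have "q \<noteq> []" by (auto simp: paths_to_def)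
  with p q have "q \<in> paths_to (last q)" "last q \<le> n"
    by (auto simp: paths_to_def sorted_wrt_append less_Suc_eq_le)
  with q show "p \<in> (\<Union>j\<in>{..n}. (\<lambda>p. p @ [Suc n]) ` paths_to j)" by blast
next
  fix p assume "p \<in> (\<Union>j\<in>{..n}. (\<lambda>p. p @ [Suc n]) ` paths_to j)"
  then obtain j q where q: "j \<le> n" "q \<in> paths_to j" "p = q @ [Suc n]" by auto
  have "x \<le> j" if "x \<in> set q" for x
    using that q by (cases q rule: rev_cases) (auto simp: paths_to_def sorted_wrt_append)
  then show "p \<in> paths_to (Suc n)"
    using q by (force simp: paths_to_def sorted_wrt_append less_Suc_eq_le)
qed

lemma path_charge_snoc:
  assumes "p \<noteq> []"
  shows "path_charge w (p @ [m]) = path_charge w p + w (last p) m"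
proof -
  obtain l where l: "length p = Suc l" using assms by (cases p) auto
  have "last p = p ! l" using assms l by (simp add: last_conv_nth)
  then show ?thesis using l by (simp add: path_charge_def nth_append)
qed

text \<open>Dynamic programming over the last edge. Adding the charge of that edge is monotone, also
  at -\<infinity>, and so commutes with the maximum over the finitely many paths to
  \<open>j\<close>.\<close>

lemma maximal_charge_Suc:
  "maximal_charge w (Suc n) = (SUP j\<in>{..n}. maximal_charge w j + w j (Suc n))"
proof -
  have Max_SUP: "maximal_charge w m = (SUP p\<in>paths_to m. path_charge w p)" for m
    unfolding maximal_charge_def
    by (intro cSup_eq_Max[symmetric]) (auto simp: finite_paths_to paths_to_nonempty)
  have "maximal_charge w (Suc n) = (SUP j\<in>{..n}. SUP p\<in>paths_to j. path_charge w (p @ [Suc n]))"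
    by (simp add: Max_SUP paths_to_Suc SUP_UNION image_image)
  also have "\<dots> = (SUP j\<in>{..n}. maximal_charge w j + w j (Suc n))"
  proof (intro SUP_cong refl)
    fix j
    have "(SUP p\<in>paths_to j. path_charge w (p @ [Suc n])) =
        (SUP p\<in>paths_to j. path_charge w p + w j (Suc n))"
      by (intro SUP_cong) (auto simp: path_charge_snoc paths_to_def)
    also have "\<dots> = Max ((\<lambda>x. x + w j (Suc n)) ` path_charge w ` paths_to j)"
      unfolding image_image
      by (intro cSup_eq_Max) (auto simp: finite_paths_to paths_to_nonempty)
    also have "\<dots> = maximal_charge w j + w j (Suc n)"
      unfolding maximal_charge_def
      by (intro mono_Max_commute[symmetric])
         (auto simp: finite_paths_to paths_to_nonempty mono_def add_right_mono)
    finally show "(SUP p\<in>paths_to j. path_charge w (p @ [Suc n])) = maximal_charge w j + w j (Suc n)" .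
  qed
  finally show ?thesis .
qed

text \<open>Row \<open>m\<close> of the fresh charges consists of the edges entering vertex
  \<open>m + 1\<close>, one from each earlier vertex \<open>k\<close>; the atoms are kept in order
  of creation.\<close>

lemma maximal_charge_eq_growth:
  "maximal_charge w n = growth (\<lambda>n y. y) (\<lambda>m k. w k (Suc m)) n n"
proof (induction n rule: less_induct)
  case (less n)
  show ?case
  proof (cases n)
    case 0
    then show ?thesis by (simp add: maximal_charge_def paths_to_0 path_charge_def)
  next
    case (Suc m)
    have "maximal_charge w j = growth (\<lambda>n y. y) (\<lambda>m k. w k (Suc m)) m j" if "j \<le> m" for j
      using less[of j] Suc that growth_stable[of j j m] by simp
    then show ?thesis
      unfolding Suc maximal_charge_Suc by (auto simp: extend_def intro!: SUP_cong)
  qed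
qed

section \<open>From atoms to point measures\<close>

text \<open>Overwriting the first atom by its value \<open>0\<close> keeps all states in \<open>point_measures\<close>.\<close>

lemma measurable_atoms_process:
  "(\<lambda>y t. atoms t (y(0 := 0))) \<in> states \<rightarrow>\<^sub>M (\<Pi>\<^sub>M t\<in>UNIV. point_measure_space)"
proof -
  have upd: "(\<lambda>y. y(0 := 0)) \<in> states \<rightarrow>\<^sub>M states"
    by (intro measurable_fun_upd[where J = UNIV] measurable_const)
       (auto simp: in_space_charge_space_iff)
  have pm: "atoms t (y(0 := 0)) \<in> point_measures" if "y \<in> space states" for t y
    using that by (intro atoms_in_point_measures) (auto simp: space_PiM)
  have "(\<lambda>y. atoms t (y(0 := 0))) \<in> states \<rightarrow>\<^sub>M point_measure_space" for t
    unfolding point_measure_space_def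
  proof (rule measurable_SUP2)
    fix A assume A: "A \<in> sets charge_space"
    show "(\<lambda>y. atoms t (y(0 := 0))) \<in> states \<rightarrow>\<^sub>M vimage_algebra point_measures (\<lambda>\<nu>. emeasure \<nu> A) borel"
      using pm by (intro measurable_vimage_algebra2
          measurable_compose[OF upd measurable_emeasure_atoms[OF A]]) auto
  qed auto
  then show ?thesis
    by (intro measurable_PiM_single') (auto simp: space_point_measure_space intro!: pm)
qed

section \<open>Transfer of the comparison to processes of point measures\<close>

theorem lemma2:
  fixes F :: "ereal measure"
    and M :: "'a measure" and \<nu> :: "nat \<Rightarrow> 'a \<Rightarrow> ereal measure"
    and N :: "'b measure" and w :: "nat \<Rightarrow> nat \<Rightarrow> 'b \<Rightarrow> ereal"
  assumes "prob_space F" and "sets F = sets charge_space"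
    and "\<And>\<epsilon>::real. \<epsilon> > 0 \<Longrightarrow> emeasure F {ereal (1 - \<epsilon>)..1} > 0"
    and "emeasure F {1<..<\<infinity>} = 0"
    and "max_growth_system M F (return charge_space 0) \<nu>"
    and "iid_charges N F {(i, j). i < j} (\<lambda>(i, j). w i j)"
  shows "eq_in_distribution (\<Pi>\<^sub>M t\<in>(UNIV :: nat set). point_measure_space)
           M (\<lambda>\<omega> t. \<nu> t \<omega>)
           N (\<lambda>\<omega> t. sum_measure charge_space {0..t}
              (\<lambda>j. return charge_space (maximal_charge (\<lambda>i k. w i k \<omega>) j)))"
proof -
  let ?S = "\<Pi>\<^sub>M t\<in>(UNIV :: nat set). point_measure_space"
  obtain v :: "nat \<Rightarrow> int \<Rightarrow> 'a \<Rightarrow> ereal" where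
    v: "iid_charges M F ({1..} \<times> UNIV) (\<lambda>(j, t). v j t)"
    and \<nu>: "\<And>\<omega>. \<omega> \<in> space M \<Longrightarrow> \<nu> 0 \<omega> = return charge_space 0"
      "\<And>\<omega> t. \<omega> \<in> space M \<Longrightarrow> \<nu> (t + 1) \<omega> = mgs_step (\<lambda>j. v j (int t + 1) \<omega>) (\<nu> t \<omega>)"
    using assms(5) unfolding max_growth_system_def by blast
  \<comment> \<open>In the step to time \<open>m + 1\<close>, the atom of rank \<open>k\<close>,
    counted from 0, receives the charge number \<open>k + 1\<close> of that time. For paths,
    \<open>d\<close> picks the edge from \<open>k\<close> to \<open>m + 1\<close>.\<close>
  define e where "e = (\<lambda>(m, k). (Suc k, int m + 1))"
  define d where "d = (\<lambda>(m, k :: nat). (k, Suc m))"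
  have e: "inj_on e {(n, k). k \<le> n}" "e \<in> {(n, k). k \<le> n} \<rightarrow> {1..} \<times> UNIV"
    by (auto simp: e_def inj_on_def)
  have d: "inj_on d {(n, k). k \<le> n}" "d \<in> {(n, k). k \<le> n} \<rightarrow> {(i, j). i < j}"
    by (auto simp: d_def inj_on_def)
  define g where "g \<omega> = growth rank (\<lambda>m k. (\<lambda>(j, t). v j t) (e (m, k)) \<omega>)" for \<omega>
  define h where "h \<omega> = growth (\<lambda>n y. y) (\<lambda>m k. (\<lambda>(i, j). w i j) (d (m, k)) \<omega>)" for \<omega>
  \<comment> \<open>One measurable map recovers both processes from the trajectories, so equality of
    the laws of the trajectories suffices.\<close>
  let ?G = "\<lambda>y t. atoms t (y(0 := 0))"
  note R = measurable_rearrangement_rank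
  have g: "(\<lambda>\<omega>. g \<omega> n) \<in> M \<rightarrow>\<^sub>M states" "(\<lambda>\<omega> t. g \<omega> t t) \<in> M \<rightarrow>\<^sub>M states" for n
    unfolding g_def by (rule measurable_growth_process[OF R v e(2)])+
  have h: "(\<lambda>\<omega> t. h \<omega> t t) \<in> N \<rightarrow>\<^sub>M states"
    unfolding h_def by (rule measurable_growth_process(2)[OF measurable_rearrangement_id assms(6) d(2)])
  have eq: "distr M states (\<lambda>\<omega> t. g \<omega> t t) = distr N states (\<lambda>\<omega> t. h \<omega> t t)"
    unfolding g_def h_def by (rule distr_growth_process_eq[OF assms(1,2) R v assms(6) e d])
  have atoms_cong: "atoms t y = atoms t z" if "\<And>j. j \<le> t \<Longrightarrow> y j = z j" for t y z
    using that by (intro measure_eqI) (auto simp: sets_atoms emeasure_atoms_sum)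
  have "\<nu> t \<omega> = atoms t (g \<omega> t)" if \<omega>: "\<omega> \<in> space M" for t \<omega>
  proof (induction t)
    case 0
    show ?case
      by (rule measure_eqI) (auto simp: \<nu>(1)[OF \<omega>] sets_atoms emeasure_atoms_sum g_def)
  next
    case (Suc t)
    have "g \<omega> t j < \<infinity>" for j
      using measurable_space[OF g(1) \<omega>, of t] by (auto simp: space_PiM)
    then show ?case
      using \<nu>(2)[OF \<omega>, of t] Suc by (simp add: mgs_step_atoms) (simp add: g_def e_def)
  qed
  \<comment> \<open>Entries up to \<open>t\<close> agree with the diagonal by
    \<open>growth_stable\<close>, and entry 0 is always 0, so the overwriting in \<open>?G\<close>
    changes nothing.\<close>
  then have \<nu>_eq: "(\<lambda>t. \<nu> t \<omega>) = ?G (\<lambda>t. g \<omega> t t)" if "\<omega> \<in> space M" for \<omega>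
    using that by (auto simp: fun_eq_iff g_def growth_at_0 intro!: atoms_cong growth_stable)
  have W_eq: "(\<lambda>t. sum_measure charge_space {0..t}
      (\<lambda>j. return charge_space (maximal_charge (\<lambda>i k. w i k \<omega>) j))) = ?G (\<lambda>t. h \<omega> t t)" for \<omega>
    unfolding atoms_def[symmetric]
    by (auto simp: fun_eq_iff h_def d_def growth_at_0 maximal_charge_eq_growth intro!: atoms_cong)
  have "(\<lambda>\<omega>. ?G (\<lambda>t. g \<omega> t t)) \<in> M \<rightarrow>\<^sub>M ?S" "(\<lambda>\<omega>. ?G (\<lambda>t. h \<omega> t t)) \<in> N \<rightarrow>\<^sub>M ?S"
    by (rule measurable_compose[OF g(2) measurable_atoms_process]
        measurable_compose[OF h measurable_atoms_process])+
  moreover have "distr M ?S (\<lambda>\<omega>. ?G (\<lambda>t. g \<omega> t t)) = distr N ?S (\<lambda>\<omega>. ?G (\<lambda>t. h \<omega> t t))"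
    using distr_distr[OF measurable_atoms_process g(2)] distr_distr[OF measurable_atoms_process h] eq
    by (simp add: comp_def)
  \<comment> \<open>The process \<open>\<nu>\<close> is known only on \<open>space M\<close>, so
    measurability and law are carried over by congruence there.\<close>
  moreover have "(\<lambda>\<omega> t. \<nu> t \<omega>) \<in> M \<rightarrow>\<^sub>M ?S \<longleftrightarrow> (\<lambda>\<omega>. ?G (\<lambda>t. g \<omega> t t)) \<in> M \<rightarrow>\<^sub>M ?S"
    by (rule measurable_cong) (rule \<nu>_eq)
  moreover have "distr M ?S (\<lambda>\<omega> t. \<nu> t \<omega>) = distr M ?S (\<lambda>\<omega>. ?G (\<lambda>t. g \<omega> t t))"
    by (intro distr_cong refl \<nu>_eq)
  ultimately show ?thesis
    unfolding eq_in_distribution_def W_eq by simp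
qed

end
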